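(* Fix $t>0$ and for each integer $n\ge 1$ let $$f_n(x)=\sqrt{\tfrac{(2n+1)(n+1)}{4n^2t}}\,(1-|x|^n)\,\mathbf 1_{[-1,1]}(x).$$ Then $$\inf_{n\ge 1}U[f_n]=\min_{n\ge 1}U[f_n]=U[f_1]=\frac{3}{10},$$ and the minimum is attained exactly at $n=1$, i.e. by the tent function $f_1(x)=\sqrt{\tfrac{3}{2t}}\,(1-|x|)\,\mathbf 1_{[-1,1]}(x)$. Moreover, the uncertainty grows linearly: $$U[f_n]\sim\frac n6\quad\text{as }n\to+\infty,$$ so that $\sup_{n\ge1}U[f_n]=+\infty$, and this value is attained when the family is extended by the rectangular function $f_0:=\operatorname{rect}=\mathbf 1_{[-1/2,1/2]}$, i.e. $U[\operatorname{rect}]=+\infty$.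
   Context: For a nonzero compactly supported $f\in L^2(\mathbb R)$, with $\|\cdot\|$ the $L^2$ norm and $\hat f(\omega)=\int_{\mathbb R}e^{-i\omega x}f(x)\,dx$, set $\alpha[f]=\frac1{\|f\|^2}\int x|f(x)|^2dx$, $\sigma_x^2[f]=\frac1{\|f\|^2}\int (x-\alpha[f])^2|f(x)|^2dx$, $\beta[\hat f]=\frac1{2\pi\|f\|^2}\int_{\mathbb R}\omega|\hat f(\omega)|^2d\omega$, $\sigma_\omega^2[\hat f]=\frac1{2\pi\|f\|^2}\int_{\mathbb R}(\omega-\beta[\hat f])^2|\hat f(\omega)|^2d\omega$, with $\sigma_\omega^2[\hat f]=+\infty$ whenever $\int\omega^2|\hat f(\omega)|^2d\omega=+\infty$, and $U[f]=\sigma_x^2[f]\,\sigma_\omega^2[\hat f]\in[0,+\infty]$. The notation $A_n\sim B_n$ means $A_n/B_n\to1$. *)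

theory Defs
  imports "HOL-Analysis.Analysis"
begin

definition l2norm :: "(real \<Rightarrow> complex) \<Rightarrow> real" where
  "l2norm f = sqrt (\<integral>x. (cmod (f x))\<^sup>2 \<partial>lborel)"

definition fourier :: "(real \<Rightarrow> complex) \<Rightarrow> real \<Rightarrow> complex" where
  "fourier f \<omega> = (\<integral>x. exp (- \<i> * complex_of_real (\<omega> * x)) * f x \<partial>lborel)"

text \<open>
  The real-valued integrals below are intended for nonzero compactly supported
  square-integrable \<open>f\<close>; for such \<open>f\<close> the time moments always converge.
\<close>

definition time_mean :: "(real \<Rightarrow> complex) \<Rightarrow> real" where
  "time_mean f = 1 / (l2norm f)\<^sup>2 * (\<integral>x. x * (cmod (f x))\<^sup>2 \<partial>lborel)"

definition time_variance :: "(real \<Rightarrow> complex) \<Rightarrow> real" where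
  "time_variance f =
     1 / (l2norm f)\<^sup>2 * (\<integral>x. (x - time_mean f)\<^sup>2 * (cmod (f x))\<^sup>2 \<partial>lborel)"

definition freq_mean :: "(real \<Rightarrow> complex) \<Rightarrow> real" where
  "freq_mean f =
     1 / (2 * pi * (l2norm f)\<^sup>2) * (\<integral>\<omega>. \<omega> * (cmod (fourier f \<omega>))\<^sup>2 \<partial>lborel)"

text \<open>
  The first frequency moment may fail to converge absolutely (the Bochner integral in
  \<open>freq_mean\<close> is then 0 by convention), but only if the second moment is infinite; the
  value of \<open>freq_mean\<close> is used only when the second moment is finite.
\<close>

definition freq_variance :: "(real \<Rightarrow> complex) \<Rightarrow> ennreal" where
  "freq_variance f =
     (if (\<integral>\<^sup>+\<omega>. ennreal (\<omega>\<^sup>2 * (cmod (fourier f \<omega>))\<^sup>2) \<partial>lborel) = \<infinity> then \<infinity>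
      else ennreal (1 / (2 * pi * (l2norm f)\<^sup>2) *
             (\<integral>\<omega>. (\<omega> - freq_mean f)\<^sup>2 * (cmod (fourier f \<omega>))\<^sup>2 \<partial>lborel)))"

definition uncertainty :: "(real \<Rightarrow> complex) \<Rightarrow> ennreal" where
  "uncertainty f = ennreal (time_variance f) * freq_variance f"

text \<open>The member \<open>n = 0\<close> is meaningless here; see \<open>ext_fam\<close>.\<close>

definition fam :: "real \<Rightarrow> nat \<Rightarrow> real \<Rightarrow> complex" where
  "fam t n x = complex_of_real
     (sqrt ((2 * real n + 1) * (real n + 1) / (4 * (real n)\<^sup>2 * t)) *
      (1 - \<bar>x\<bar> ^ n) * indicator {-1..1} x)"

definition rect :: "real \<Rightarrow> complex" where
  "rect x = complex_of_real (indicator {-1/2..1/2} x)"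

definition ext_fam :: "real \<Rightarrow> nat \<Rightarrow> real \<Rightarrow> complex" where
  "ext_fam t n = (if n = 0 then rect else fam t n)"

end

theory Submission
  imports Defs "HOL-Probability.Characteristic_Functions" "HOL-Real_Asymp.Real_Asymp"
begin

text \<open>
  Every \<open>f\<^sub>n\<close> is real, even, and continuous with \<open>f\<^sub>n(\<plusminus>1) = 0\<close>, so both means vanish and the
  transform of the piecewise derivative \<open>f\<^sub>n'\<close> is \<open>\<i> \<omega>\<close> times that of \<open>f\<^sub>n\<close> (\<open>fourier_derivative\<close>).
  The Plancherel identity for \<open>f\<^sub>n'\<close> (\<open>plancherel\<close>) then gives
  \<open>\<sigma>\<^sub>\<omega>\<^sup>2 = \<parallel>f\<^sub>n'\<parallel>\<^sup>2 / \<parallel>f\<^sub>n\<parallel>\<^sup>2\<close>, and all that remains to compute are moments of powers of \<open>\<bar>x\<bar>\<close> on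
  \<open>[-1, 1]\<close>.  The outcome (\<open>uncertainty_fam\<close>) is
  \<open>U[f\<^sub>n] = (n + 1)\<^sup>2 (2n + 1)\<^sup>2 / (6 (n + 3) (2n + 3) (2n - 1))\<close>,
  a rational function of \<open>n\<close> that equals \<open>3/10\<close> at \<open>n = 1\<close>, exceeds it for \<open>n \<ge> 2\<close>, and is
  asymptotic to \<open>n/6\<close>.

  The Plancherel identity is needed only for bounded, integrable, almost everywhere continuous
  functions, where Gaussian summability proves it directly: with the weight \<open>exp (- (\<epsilon>\<omega>)\<^sup>2 / 2)\<close>
  inserted, Fubini's theorem turns \<open>\<integral>\<bar>(fourier g)(\<omega>)\<bar>\<^sup>2\<close> into \<open>2\<pi> \<integral>g(x) \<integral>cnj (g(x + \<epsilon>z)) \<phi>(z) dz dx\<close> with the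
  standard normal density \<open>\<phi>\<close> (\<open>gaussian_parseval\<close>).  As \<open>\<epsilon>\<close> tends to \<open>0\<close>, the first side converges
  monotonically and the second one dominatedly.

  For the rectangular function \<open>\<omega>\<^sup>2\<close> times the squared modulus of its transform is
  \<open>4 sin\<^sup>2 (\<omega>/2)\<close>, which is not integrable.
\<close>

section \<open>Fourier transforms of integrable functions\<close>

lemma norm_exp_fourier_kernel [simp]: "cmod (exp (- (\<i> * (of_real a * of_real b)))) = 1"
  by (simp add: norm_exp_eq_Re)

lemma integrable_fourier_kernel:
  assumes "integrable lborel g"
  shows "integrable lborel (\<lambda>x. exp (- \<i> * complex_of_real (\<omega> * x)) * g x)"
proof (rule Bochner_Integration.integrable_bound[OF assms])
  have [measurable]: "g \<in> borel_measurable borel"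
    using assms by auto
  show "(\<lambda>x. exp (- \<i> * complex_of_real (\<omega> * x)) * g x) \<in> borel_measurable lborel"
    by measurable
qed (simp add: norm_mult)

lemma norm_fourier_le: "cmod (fourier g \<omega>) \<le> (\<integral>x. cmod (g x) \<partial>lborel)"
proof -
  have "cmod (fourier g \<omega>) \<le> (\<integral>x. cmod (exp (- \<i> * complex_of_real (\<omega> * x)) * g x) \<partial>lborel)"
    unfolding fourier_def by (rule integral_norm_bound)
  also have "\<dots> = (\<integral>x. cmod (g x) \<partial>lborel)"
    by (simp add: norm_mult)
  finally show ?thesis .
qed

lemma borel_measurable_fourier [measurable]:
  assumes "integrable lborel g"
  shows "fourier g \<in> borel_measurable borel"
proof -
  have [measurable]: "g \<in> borel_measurable borel"
    using assms by auto
  have "(\<lambda>\<omega>. \<integral>x. exp (- \<i> * complex_of_real (\<omega> * x)) * g x \<partial>lborel) \<in> borel_measurable borel"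
    by measurable
  then show ?thesis
    by (simp add: fourier_def[abs_def])
qed

lemma integrable_mult_fourier:
  assumes g: "integrable lborel g" and h: "integrable lborel h"
  shows "integrable lborel (\<lambda>\<omega>. fourier g \<omega> * h \<omega>)"
proof (rule Bochner_Integration.integrable_bound)
  show "integrable lborel (\<lambda>\<omega>. (\<integral>x. cmod (g x) \<partial>lborel) * cmod (h \<omega>))"
    using h by simp
  have [measurable]: "fourier g \<in> borel_measurable borel" "h \<in> borel_measurable borel"
    using g h by auto
  show "(\<lambda>\<omega>. fourier g \<omega> * h \<omega>) \<in> borel_measurable lborel"
    by measurable
  show "AE \<omega> in lborel. cmod (fourier g \<omega> * h \<omega>) \<le> norm ((\<integral>x. cmod (g x) \<partial>lborel) * cmod (h \<omega>))"
    by (simp add: norm_mult mult_right_mono norm_fourier_le abs_mult)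
qed

text \<open>The multiplication formula: Fubini's theorem moves the transform to the other factor.\<close>

lemma fourier_multiplication_formula:
  assumes g: "integrable lborel g" and h: "integrable lborel h"
  shows "(\<integral>\<omega>. fourier g \<omega> * h \<omega> \<partial>lborel) = (\<integral>x. g x * fourier h x \<partial>lborel)"
proof -
  have [measurable]: "g \<in> borel_measurable borel" "h \<in> borel_measurable borel"
    using g h by auto
  let ?F = "\<lambda>\<omega> x. exp (- \<i> * complex_of_real (\<omega> * x)) * g x * h \<omega>"
  have int: "integrable (lborel \<Otimes>\<^sub>M lborel) (\<lambda>(\<omega>, x). ?F \<omega> x)"
  proof (rule lborel_pair.Fubini_integrable)
    show "(\<lambda>(\<omega>, x). ?F \<omega> x) \<in> borel_measurable (lborel \<Otimes>\<^sub>M lborel)"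
      by measurable
    show "integrable lborel (\<lambda>\<omega>. \<integral>x. norm (case (\<omega>, x) of (\<omega>, x) \<Rightarrow> ?F \<omega> x) \<partial>lborel)"
      using h by (simp add: norm_mult)
    show "AE \<omega> in lborel. integrable lborel (\<lambda>x. case (\<omega>, x) of (\<omega>, x) \<Rightarrow> ?F \<omega> x)"
      using integrable_fourier_kernel[OF g] by simp
  qed
  have "(\<integral>\<omega>. fourier g \<omega> * h \<omega> \<partial>lborel) = (\<integral>\<omega>. \<integral>x. ?F \<omega> x \<partial>lborel \<partial>lborel)"
    by (simp add: fourier_def)
  also have "\<dots> = (\<integral>x. \<integral>\<omega>. ?F \<omega> x \<partial>lborel \<partial>lborel)"
    by (rule lborel_pair.Fubini_integral[OF int, symmetric])
  also have "\<dots> = (\<integral>x. \<integral>\<omega>. g x * (exp (- \<i> * complex_of_real (x * \<omega>)) * h \<omega>) \<partial>lborel \<partial>lborel)"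
    by (simp add: mult_ac)
  also have "\<dots> = (\<integral>x. g x * fourier h x \<partial>lborel)"
    by (simp add: fourier_def)
  finally show ?thesis .
qed

lemma cnj_fourier: "cnj (fourier g \<omega>) = fourier (\<lambda>x. cnj (g x)) (- \<omega>)"
proof -
  have "cnj (fourier g \<omega>) = (\<integral>x. cnj (exp (- \<i> * complex_of_real (\<omega> * x)) * g x) \<partial>lborel)"
    by (simp only: fourier_def Bochner_Integration.integral_cnj)
  then show ?thesis
    by (simp add: fourier_def exp_cnj)
qed

lemma fourier_iexp_mult:
  "fourier (\<lambda>\<omega>. exp (\<i> * complex_of_real (x * \<omega>)) * h \<omega>) y = fourier h (y - x)"
proof -
  have "exp (- \<i> * complex_of_real (y * \<omega>)) * exp (\<i> * complex_of_real (x * \<omega>))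
      = exp (- \<i> * complex_of_real ((y - x) * \<omega>))" for \<omega>
    unfolding exp_add[symmetric] by (simp add: algebra_simps)
  then show ?thesis
    unfolding fourier_def mult.assoc[symmetric] by simp
qed

section \<open>Gaussian summability and the Plancherel identity\<close>

lemma integrable_gaussian:
  fixes \<epsilon> :: real
  assumes "\<epsilon> > 0"
  shows "integrable lborel (\<lambda>\<omega>. exp (- (\<epsilon> * \<omega>)\<^sup>2 / 2))"
proof -
  have "integrable lborel (\<lambda>\<omega>. sqrt (2 * pi) * std_normal_density (0 + \<epsilon> * \<omega>))"
    using assms by (intro integrable_mult_right lborel_integrable_real_affine) auto
  then show ?thesis
    by (simp add: std_normal_density_def)
qed

text \<open>The transform of a Gaussian is again a Gaussian, read off the characteristic function of the
  standard normal distribution.\<close>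

lemma fourier_gaussian:
  assumes "\<epsilon> > 0"
  shows "fourier (\<lambda>\<omega>. complex_of_real (exp (- (\<epsilon> * \<omega>)\<^sup>2 / 2))) u
           = complex_of_real (2 * pi / \<epsilon> * std_normal_density (u / \<epsilon>))"
proof -
  have char: "(\<integral>x. std_normal_density x *\<^sub>R exp (\<i> * complex_of_real (s * x)) \<partial>lborel)
      = complex_of_real (exp (- s\<^sup>2 / 2))" for s
    using fun_cong[OF char_std_normal_distribution, of s]
    by (simp add: char_def integral_density)
  have "complex_of_real (exp (- (- u / \<epsilon>)\<^sup>2 / 2))
      = \<bar>\<epsilon>\<bar> *\<^sub>R (\<integral>x. std_normal_density (0 + \<epsilon> * x)
          *\<^sub>R exp (\<i> * complex_of_real (- u / \<epsilon> * (0 + \<epsilon> * x))) \<partial>lborel)"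
    unfolding char[symmetric] by (rule lborel_integral_real_affine) (use assms in auto)
  also have "\<dots> = \<bar>\<epsilon>\<bar> *\<^sub>R (\<integral>x. complex_of_real (1 / sqrt (2 * pi)) *
      (exp (- \<i> * complex_of_real (u * x)) * complex_of_real (exp (- (\<epsilon> * x)\<^sup>2 / 2))) \<partial>lborel)"
    using assms by (simp add: std_normal_density_def scaleR_conv_of_real mult_ac)
  also have "\<dots> = complex_of_real (\<epsilon> / sqrt (2 * pi))
      * fourier (\<lambda>\<omega>. complex_of_real (exp (- (\<epsilon> * \<omega>)\<^sup>2 / 2))) u"
    using assms by (simp add: fourier_def scaleR_conv_of_real)
  finally have eq: "complex_of_real (exp (- (- u / \<epsilon>)\<^sup>2 / 2)) = complex_of_real (\<epsilon> / sqrt (2 * pi))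
      * fourier (\<lambda>\<omega>. complex_of_real (exp (- (\<epsilon> * \<omega>)\<^sup>2 / 2))) u" .
  have "fourier (\<lambda>\<omega>. complex_of_real (exp (- (\<epsilon> * \<omega>)\<^sup>2 / 2))) u
      = complex_of_real (sqrt (2 * pi) / \<epsilon>) * complex_of_real (exp (- (- u / \<epsilon>)\<^sup>2 / 2))"
    unfolding eq using assms by simp
  also have "sqrt (2 * pi) / \<epsilon> = 2 * pi / \<epsilon> * (1 / sqrt (2 * pi))"
    using assms by (simp add: field_simps)
  finally show ?thesis
    by (simp add: std_normal_density_def)
qed

text \<open>A regularised Plancherel identity.  The multiplication formula is applied twice: once to
  \<open>g\<close>, and once, after the reflection \<open>\<omega> \<mapsto> - \<omega>\<close>, to \<open>cnj \<circ> g\<close> in the inner integral, which puts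
  the transform on the Gaussian weight.\<close>

lemma gaussian_parseval:
  assumes g: "integrable lborel g" and \<epsilon>: "\<epsilon> > 0"
  shows "(\<integral>\<omega>. complex_of_real (exp (- (\<epsilon> * \<omega>)\<^sup>2 / 2) * (cmod (fourier g \<omega>))\<^sup>2) \<partial>lborel)
    = 2 * pi * (\<integral>x. g x * (\<integral>z. cnj (g (x + \<epsilon> * z)) * std_normal_density z \<partial>lborel) \<partial>lborel)"
    (is "?lhs = _")
proof -
  define w where "w = (\<lambda>\<omega>. complex_of_real (exp (- (\<epsilon> * \<omega>)\<^sup>2 / 2)))"
  have w: "integrable lborel w"
    unfolding w_def using integrable_gaussian[OF \<epsilon>] by (rule integrable_of_real)
  have w_even: "w (- \<omega>) = w \<omega>" for \<omega>
    by (simp add: w_def)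
  have gc: "integrable lborel (\<lambda>x. cnj (g x))"
    using g by simp
  have wg: "integrable lborel (\<lambda>\<omega>. w \<omega> * cnj (fourier g \<omega>))"
  proof -
    have "integrable lborel (\<lambda>\<omega>. cnj (fourier g \<omega> * cnj (w \<omega>)))"
      using integrable_mult_fourier[OF g, of "\<lambda>x. cnj (w x)"] w by (intro integrable_cnj) simp
    then show ?thesis by (simp add: mult.commute)
  qed
  have inner: "fourier (\<lambda>\<omega>. w \<omega> * cnj (fourier g \<omega>)) x
    = 2 * pi * (\<integral>z. cnj (g (x + \<epsilon> * z)) * std_normal_density z \<partial>lborel)" for x
  proof -
    let ?h = "\<lambda>\<omega>. exp (\<i> * complex_of_real (x * \<omega>)) * w \<omega>"
    have h: "integrable lborel ?h"
      using integrable_fourier_kernel[OF w, of "- x"] by simp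
    have "fourier (\<lambda>\<omega>. w \<omega> * cnj (fourier g \<omega>)) x
      = (\<integral>\<omega>. exp (- \<i> * complex_of_real (x * (0 + -1 * \<omega>))) * (w (0 + -1 * \<omega>)
          * cnj (fourier g (0 + -1 * \<omega>))) \<partial>lborel)"
      unfolding fourier_def[of _ x] by (subst lborel_integral_real_affine[of "-1" _ 0]) simp_all
    also have "\<dots> = (\<integral>\<omega>. fourier (\<lambda>x. cnj (g x)) \<omega> * ?h \<omega> \<partial>lborel)"
      by (simp add: cnj_fourier w_even mult_ac)
    also have "\<dots> = (\<integral>y. cnj (g y) * fourier ?h y \<partial>lborel)"
      by (rule fourier_multiplication_formula[OF gc h])
    also have "\<dots> = (\<integral>y. cnj (g y) * complex_of_real (2 * pi / \<epsilon> * std_normal_density ((y - x) / \<epsilon>)) \<partial>lborel)"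
      by (simp only: fourier_iexp_mult) (simp only: w_def fourier_gaussian[OF \<epsilon>])
    also have "\<dots> = \<bar>\<epsilon>\<bar> *\<^sub>R (\<integral>z. cnj (g (x + \<epsilon> * z)) *
        complex_of_real (2 * pi / \<epsilon> * std_normal_density ((x + \<epsilon> * z - x) / \<epsilon>)) \<partial>lborel)"
      by (rule lborel_integral_real_affine) (use \<epsilon> in auto)
    also have "\<dots> = \<bar>\<epsilon>\<bar> *\<^sub>R (\<integral>z. complex_of_real (2 * pi / \<epsilon>) *
        (cnj (g (x + \<epsilon> * z)) * std_normal_density z) \<partial>lborel)"
      using \<epsilon> by (simp add: mult_ac)
    also have "\<dots> = 2 * pi * (\<integral>z. cnj (g (x + \<epsilon> * z)) * std_normal_density z \<partial>lborel)"
      using \<epsilon> by (simp only: integral_mult_right_zero) (simp add: scaleR_conv_of_real)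
    finally show ?thesis .
  qed
  have "?lhs = (\<integral>\<omega>. fourier g \<omega> * (w \<omega> * cnj (fourier g \<omega>)) \<partial>lborel)"
    by (simp only: w_def of_real_mult complex_norm_square mult_ac)
  also have "\<dots> = (\<integral>x. g x * fourier (\<lambda>\<omega>. w \<omega> * cnj (fourier g \<omega>)) x \<partial>lborel)"
    by (rule fourier_multiplication_formula[OF g wg])
  also have "\<dots> = (\<integral>x. complex_of_real (2 * pi) *
      (g x * (\<integral>z. cnj (g (x + \<epsilon> * z)) * std_normal_density z \<partial>lborel)) \<partial>lborel)"
    by (simp add: inner mult_ac)
  also have "\<dots> = 2 * pi * (\<integral>x. g x * (\<integral>z. cnj (g (x + \<epsilon> * z)) * std_normal_density z \<partial>lborel) \<partial>lborel)"
    by (simp only: integral_mult_right_zero)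
  finally show ?thesis .
qed

text \<open>Boundedness and almost everywhere continuity let dominated convergence identify the limit of the
  Gaussian averages of \<open>g\<close> pointwise, without appeal to continuity of translations in \<open>L\<^sup>2\<close>.  The
  left-hand side is a nonnegative integral, so finiteness is part of the conclusion.\<close>

theorem plancherel:
  assumes g: "integrable lborel g" and M: "\<And>x. cmod (g x) \<le> M"
    and cont: "AE x in lborel. isCont g x"
  shows "(\<integral>\<^sup>+\<omega>. ennreal ((cmod (fourier g \<omega>))\<^sup>2) \<partial>lborel)
    = ennreal (2 * pi * (\<integral>x. (cmod (g x))\<^sup>2 \<partial>lborel))"
proof -
  have gm[measurable]: "g \<in> borel_measurable borel"
    using g by auto
  have Fm[measurable]: "fourier g \<in> borel_measurable borel"
    using g by auto
  define \<epsilon> where "\<epsilon> k = inverse (real (Suc k))" for k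
  have \<epsilon>_pos: "\<epsilon> k > 0" for k
    by (simp add: \<epsilon>_def)
  have \<epsilon>_lim: "\<epsilon> \<longlonglongrightarrow> 0"
    unfolding \<epsilon>_def[abs_def] by (rule LIMSEQ_inverse_real_of_nat)
  define \<phi> where "\<phi> = std_normal_density"
  have \<phi>: "integrable lborel \<phi>" "(\<integral>z. \<phi> z \<partial>lborel) = 1" "\<And>z. 0 \<le> \<phi> z"
    by (auto simp: \<phi>_def)
  have \<phi>m[measurable]: "\<phi> \<in> borel_measurable borel"
    by (simp add: \<phi>_def)
  have gcm[measurable]: "(\<lambda>x. cnj (g x)) \<in> borel_measurable borel"
    using borel_measurable_integrable[OF integrable_cnj[OF g]] by simp
  \<comment> \<open>Gaussian averages of \<open>cnj \<circ> g\<close> around \<open>x\<close> at scale \<open>\<epsilon> k\<close>.\<close>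
  define A where "A k x = (\<integral>z. cnj (g (x + \<epsilon> k * z)) * \<phi> z \<partial>lborel)" for k x
  have Am[measurable]: "A k \<in> borel_measurable borel" for k
    unfolding A_def[abs_def] by measurable
  have A_bound: "cmod (A k x) \<le> M" for k x
  proof -
    have "cmod (A k x) \<le> (\<integral>z. M * \<phi> z \<partial>lborel)"
      unfolding A_def
    proof (rule Bochner_Integration.integral_norm_bound_integral)
      show bd: "cmod (cnj (g (x + \<epsilon> k * z)) * \<phi> z) \<le> M * \<phi> z" for z
        using M \<phi>(3) by (simp add: norm_mult mult_right_mono)
      show "integrable lborel (\<lambda>z. M * \<phi> z)"
        using \<phi> by simp
      then show "integrable lborel (\<lambda>z. cnj (g (x + \<epsilon> k * z)) * \<phi> z)"
        by (rule Bochner_Integration.integrable_bound)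
           (use bd in \<open>auto intro!: AE_I2 order.trans[OF bd]\<close>)
    qed
    then show ?thesis using \<phi> by simp
  qed
  have A_lim: "AE x in lborel. (\<lambda>k. A k x) \<longlonglongrightarrow> cnj (g x)"
    using cont
  proof eventually_elim
    case (elim x)
    have "(\<lambda>k. A k x) \<longlonglongrightarrow> (\<integral>z. cnj (g x) * \<phi> z \<partial>lborel)"
      unfolding A_def
    proof (rule integral_dominated_convergence)
      show "integrable lborel (\<lambda>z. M * \<phi> z)"
        using \<phi> by simp
      show "AE z in lborel. (\<lambda>k. cnj (g (x + \<epsilon> k * z)) * \<phi> z) \<longlonglongrightarrow> cnj (g x) * \<phi> z"
      proof (rule AE_I2)
        fix z
        have "(\<lambda>k. x + \<epsilon> k * z) \<longlonglongrightarrow> x + 0 * z"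
          by (intro tendsto_intros \<epsilon>_lim)
        then have "(\<lambda>k. x + \<epsilon> k * z) \<longlonglongrightarrow> x"
          by simp
        then have "(\<lambda>k. g (x + \<epsilon> k * z)) \<longlonglongrightarrow> g x"
          by (rule isCont_tendsto_compose[OF elim])
        then show "(\<lambda>k. cnj (g (x + \<epsilon> k * z)) * \<phi> z) \<longlonglongrightarrow> cnj (g x) * \<phi> z"
          by (intro tendsto_intros)
      qed
      show "AE z in lborel. cmod (cnj (g (x + \<epsilon> k * z)) * \<phi> z) \<le> M * \<phi> z" for k
        using M \<phi>(3) by (simp add: norm_mult mult_right_mono)
    qed measurable
    then show ?case
      using \<phi> by simp
  qed
  have lim: "(\<lambda>k. \<integral>x. g x * A k x \<partial>lborel) \<longlonglongrightarrow> (\<integral>x. g x * cnj (g x) \<partial>lborel)"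
  proof (rule integral_dominated_convergence)
    show "integrable lborel (\<lambda>x. cmod (g x) * M)"
      using g by simp
    show "AE x in lborel. (\<lambda>k. g x * A k x) \<longlonglongrightarrow> g x * cnj (g x)"
      using A_lim by eventually_elim (intro tendsto_intros)
    show "AE x in lborel. cmod (g x * A k x) \<le> cmod (g x) * M" for k
      using A_bound by (simp add: norm_mult mult_left_mono)
  qed measurable
  \<comment> \<open>The Gaussian-weighted energy density, increasing in \<open>k\<close> to \<open>(cmod (fourier g \<omega>))\<^sup>2\<close>.\<close>
  define W where "W k \<omega> = exp (- (\<epsilon> k * \<omega>)\<^sup>2 / 2) * (cmod (fourier g \<omega>))\<^sup>2" for k \<omega>
  have Wm[measurable]: "W k \<in> borel_measurable borel" for k
    unfolding W_def[abs_def] by measurable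
  have W_nonneg: "0 \<le> W k \<omega>" for k \<omega>
    by (simp add: W_def)
  have W_int: "integrable lborel (W k)" for k
  proof (rule Bochner_Integration.integrable_bound)
    show "integrable lborel (\<lambda>\<omega>. exp (- (\<epsilon> k * \<omega>)\<^sup>2 / 2) * (\<integral>x. cmod (g x) \<partial>lborel)\<^sup>2)"
      using integrable_gaussian[OF \<epsilon>_pos] by simp
    show "AE \<omega> in lborel. norm (W k \<omega>) \<le> norm (exp (- (\<epsilon> k * \<omega>)\<^sup>2 / 2) * (\<integral>x. cmod (g x) \<partial>lborel)\<^sup>2)"
      by (intro AE_I2) (auto simp: W_def abs_mult intro!: mult_left_mono power_mono norm_fourier_le)
  qed measurable
  have "complex_of_real (\<integral>\<omega>. W k \<omega> \<partial>lborel) = complex_of_real (2 * pi) * (\<integral>x. g x * A k x \<partial>lborel)" for k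
    using gaussian_parseval[OF g \<epsilon>_pos, of k]
    unfolding A_def \<phi>_def W_def integral_complex_of_real[symmetric] by simp
  then have "(\<lambda>k. complex_of_real (\<integral>\<omega>. W k \<omega> \<partial>lborel))
      \<longlonglongrightarrow> complex_of_real (2 * pi) * (\<integral>x. g x * cnj (g x) \<partial>lborel)"
    using tendsto_mult[OF tendsto_const lim] by simp
  also have "(\<integral>x. g x * cnj (g x) \<partial>lborel) = complex_of_real (\<integral>x. (cmod (g x))\<^sup>2 \<partial>lborel)"
    by (simp only: complex_norm_square[symmetric] integral_complex_of_real)
  finally have "(\<lambda>k. complex_of_real (\<integral>\<omega>. W k \<omega> \<partial>lborel))
      \<longlonglongrightarrow> complex_of_real (2 * pi * (\<integral>x. (cmod (g x))\<^sup>2 \<partial>lborel))"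
    by simp
  then have "(\<lambda>k. \<integral>\<omega>. W k \<omega> \<partial>lborel) \<longlonglongrightarrow> 2 * pi * (\<integral>x. (cmod (g x))\<^sup>2 \<partial>lborel)"
    by (simp only: tendsto_of_real_iff)
  then have 1: "(\<lambda>k. \<integral>\<^sup>+\<omega>. ennreal (W k \<omega>) \<partial>lborel) \<longlonglongrightarrow> ennreal (2 * pi * (\<integral>x. (cmod (g x))\<^sup>2 \<partial>lborel))"
    by (simp add: nn_integral_eq_integral[OF W_int] W_nonneg)
  have 2: "(\<lambda>k. \<integral>\<^sup>+\<omega>. ennreal (W k \<omega>) \<partial>lborel) \<longlonglongrightarrow> (\<integral>\<^sup>+\<omega>. ennreal ((cmod (fourier g \<omega>))\<^sup>2) \<partial>lborel)"
  proof (rule nn_integral_LIMSEQ)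
    show "incseq (\<lambda>k \<omega>. ennreal (W k \<omega>))"
    proof (intro incseq_SucI le_funI ennreal_leI)
      fix k \<omega>
      have "\<epsilon> (Suc k) \<le> \<epsilon> k"
        by (simp add: \<epsilon>_def)
      then have "(\<epsilon> (Suc k) * \<omega>)\<^sup>2 \<le> (\<epsilon> k * \<omega>)\<^sup>2"
        using \<epsilon>_pos[of "Suc k"] by (simp add: power_mult_distrib mult_right_mono power_mono)
      then show "W k \<omega> \<le> W (Suc k) \<omega>"
        by (simp add: W_def mult_right_mono)
    qed
    fix \<omega>
    have "(\<lambda>k. W k \<omega>) \<longlonglongrightarrow> exp (- (0 * \<omega>)\<^sup>2 / 2) * (cmod (fourier g \<omega>))\<^sup>2"
      unfolding W_def by (intro tendsto_intros \<epsilon>_lim) simp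
    then show "(\<lambda>k. ennreal (W k \<omega>)) \<longlonglongrightarrow> ennreal ((cmod (fourier g \<omega>))\<^sup>2)"
      by (intro tendsto_ennrealI) simp
  qed measurable
  show ?thesis
    by (rule LIMSEQ_unique[OF 2 1])
qed

section \<open>Derivatives and moments\<close>

lemma has_vector_derivative_fourier_kernel:
  "((\<lambda>x. exp (- \<i> * complex_of_real (\<omega> * x))) has_vector_derivative
    (- \<i> * complex_of_real \<omega>) * exp (- \<i> * complex_of_real (\<omega> * x))) (at x within A)"
proof -
  have "((\<lambda>z. exp (- \<i> * complex_of_real \<omega> * z)) has_field_derivative
      (- \<i> * complex_of_real \<omega>) * exp (- \<i> * complex_of_real \<omega> * complex_of_real x))
      (at (complex_of_real x))"
    by (auto intro!: derivative_eq_intros)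
  from has_vector_derivative_real_field[OF this] show ?thesis
    by (simp add: mult.assoc)
qed

text \<open>Integration by parts for a continuous function that vanishes at the ends of its supporting
  interval; corners are allowed at the finitely many points of \<open>S\<close>, where \<open>g\<close> is arbitrary.\<close>

lemma fourier_derivative:
  assumes ab: "a \<le> b" and S: "finite S"
    and cont: "continuous_on {a..b} f" and f0: "f a = 0" "f b = 0"
    and f_out: "\<And>x. x \<notin> {a..b} \<Longrightarrow> f x = 0" and g_out: "\<And>x. x \<notin> {a..b} \<Longrightarrow> g x = 0"
    and deriv: "\<And>x. x \<in> {a<..<b} - S \<Longrightarrow> (f has_vector_derivative g x) (at x)"
    and g: "integrable lborel g"
  shows "integrable lborel f" and "fourier g \<omega> = \<i> * complex_of_real \<omega> * fourier f \<omega>"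
proof -
  have "integrable lborel (\<lambda>x. indicator {a..b} x *\<^sub>R f x)"
    by (intro borel_integrable_compact cont) auto
  also have "(\<lambda>x. indicator {a..b} x *\<^sub>R f x) = f"
    using f_out by (auto simp: fun_eq_iff indicator_def)
  finally show f: "integrable lborel f" .
  define E where "E x = exp (- \<i> * complex_of_real (\<omega> * x))" for x
  define h where "h x = E x * g x + (- \<i> * complex_of_real \<omega>) * (E x * f x)" for x
  have E_deriv: "(E has_vector_derivative (- \<i> * complex_of_real \<omega>) * E x) (at x)" for x
    unfolding E_def by (rule has_vector_derivative_fourier_kernel)
  have E_cont: "continuous_on A E" for A
    unfolding E_def[abs_def] by (intro continuous_intros)
  have int: "integrable lborel (\<lambda>x. E x * g x)" "integrable lborel (\<lambda>x. E x * f x)"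
    unfolding E_def by (rule integrable_fourier_kernel, fact)+
  \<comment> \<open>\<open>h\<close> is the derivative of \<open>E \<cdot> f\<close> off \<open>S\<close>, so its integral is a difference of boundary values.\<close>
  have "(h has_integral E b * f b - E a * f a) {a..b}"
  proof (rule fundamental_theorem_of_calculus_interior_strong[OF S ab])
    show "continuous_on {a..b} (\<lambda>x. E x * f x)"
      by (intro continuous_intros E_cont cont)
    show "((\<lambda>x. E x * f x) has_vector_derivative h x) (at x)" if "x \<in> {a<..<b} - S" for x
      using has_vector_derivative_mult[OF E_deriv deriv[OF that]] by (simp add: h_def mult_ac)
  qed
  then have "(h has_integral 0) {a..b}"
    by (simp add: f0)
  moreover have "h x = 0" if "x \<notin> {a..b}" for x
    unfolding h_def f_out[OF that] g_out[OF that] by simp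
  ultimately have "(h has_integral 0) UNIV"
    by (rule has_integral_on_superset) auto
  moreover have "integrable lborel h"
    unfolding h_def[abs_def] using int by (intro Bochner_Integration.integrable_add integrable_mult_right)
  then have "(h has_integral (integral\<^sup>L lborel h)) UNIV"
    by (rule has_integral_integral_lborel)
  ultimately have "integral\<^sup>L lborel h = 0"
    by (simp add: has_integral_unique)
  moreover have "integral\<^sup>L lborel h = fourier g \<omega> + (- \<i> * complex_of_real \<omega>) * fourier f \<omega>"
    unfolding h_def[abs_def] fourier_def E_def[symmetric]
    by (simp only: Bochner_Integration.integral_add[OF int(1) integrable_mult_right[OF int(2)]]
        integral_mult_right_zero)
  ultimately show "fourier g \<omega> = \<i> * complex_of_real \<omega> * fourier f \<omega>"
    by simp
qed

text \<open>Integrability of \<open>h\<close> is not needed: the Bochner integral of a non-integrable function is \<open>0\<close>.\<close>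

lemma integral_odd_eq_0:
  fixes h :: "real \<Rightarrow> real"
  assumes "\<And>x. h (- x) = - h x"
  shows "(\<integral>x. h x \<partial>lborel) = 0"
proof -
  have "(\<integral>x. h x \<partial>lborel) = (\<integral>x. h (0 + -1 * x) \<partial>lborel)"
    by (subst lborel_integral_real_affine[of "-1" _ 0]) simp_all
  then show ?thesis
    using assms by simp
qed

lemma time_mean_even:
  assumes "\<And>x. cmod (f (- x)) = cmod (f x)"
  shows "time_mean f = 0"
  unfolding time_mean_def by (subst integral_odd_eq_0) (auto simp: assms)

lemma freq_mean_real:
  assumes "\<And>x. cnj (f x) = f x"
  shows "freq_mean f = 0"
proof -
  have "cmod (fourier f (- \<omega>)) = cmod (fourier f \<omega>)" for \<omega>
    using arg_cong[OF cnj_fourier[of f \<omega>], of cmod] assms by simp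
  then show ?thesis
    unfolding freq_mean_def by (subst integral_odd_eq_0) auto
qed

lemma l2norm_power2: "(l2norm f)\<^sup>2 = (\<integral>x. (cmod (f x))\<^sup>2 \<partial>lborel)"
  by (simp add: l2norm_def)

text \<open>The frequency variance of a real function is the energy of its derivative relative to its own.\<close>

lemma freq_variance_eq_derivative_energy:
  assumes ab: "a \<le> b" and S: "finite S"
    and cont: "continuous_on {a..b} f" and f0: "f a = 0" "f b = 0"
    and f_out: "\<And>x. x \<notin> {a..b} \<Longrightarrow> f x = 0" and g_out: "\<And>x. x \<notin> {a..b} \<Longrightarrow> g x = 0"
    and deriv: "\<And>x. x \<in> {a<..<b} - S \<Longrightarrow> (f has_vector_derivative g x) (at x)"
    and g: "integrable lborel g" and M: "\<And>x. cmod (g x) \<le> M"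
    and g_cont: "AE x in lborel. isCont g x"
    and f_real: "\<And>x. cnj (f x) = f x"
  shows "freq_variance f = ennreal ((\<integral>x. (cmod (g x))\<^sup>2 \<partial>lborel) / (l2norm f)\<^sup>2)"
proof -
  have f: "integrable lborel f"
    using fourier_derivative(1)[OF ab S cont f0 f_out g_out deriv g] by blast
  have fg: "fourier g \<omega> = \<i> * complex_of_real \<omega> * fourier f \<omega>" for \<omega>
    using fourier_derivative(2)[OF ab S cont f0 f_out g_out deriv g] by blast
  have [measurable]: "fourier f \<in> borel_measurable borel"
    using f by (rule borel_measurable_fourier)
  have "\<omega>\<^sup>2 * (cmod (fourier f \<omega>))\<^sup>2 = (cmod (fourier g \<omega>))\<^sup>2" for \<omega>
    by (simp add: fg norm_mult power_mult_distrib)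
  then have nn: "(\<integral>\<^sup>+\<omega>. ennreal (\<omega>\<^sup>2 * (cmod (fourier f \<omega>))\<^sup>2) \<partial>lborel)
      = ennreal (2 * pi * (\<integral>x. (cmod (g x))\<^sup>2 \<partial>lborel))"
    using plancherel[OF g M g_cont] by simp
  have "(\<integral>\<omega>. \<omega>\<^sup>2 * (cmod (fourier f \<omega>))\<^sup>2 \<partial>lborel) = 2 * pi * (\<integral>x. (cmod (g x))\<^sup>2 \<partial>lborel)"
    by (subst integral_eq_nn_integral) (auto simp: nn)
  then show ?thesis
    unfolding freq_variance_def nn by (simp add: freq_mean_real[OF f_real])
qed

section \<open>The truncated powers\<close>

lemma has_bochner_integral_abs_power:
  "has_bochner_integral lborel (\<lambda>x::real. \<bar>x\<bar> ^ k * indicator {-1..1} x) (2 / (real k + 1))"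
proof -
  have "has_bochner_integral lborel (\<lambda>x. x ^ k * indicator {0..1} x)
      (1 ^ Suc k / (real k + 1) - 0 ^ Suc k / (real k + 1))"
  proof (rule has_bochner_integral_FTC_Icc_real)
    show "((\<lambda>x. x ^ Suc k / (real k + 1)) has_real_derivative x ^ k) (at x)" for x
      by (rule derivative_eq_intros refl | simp)+ (simp add: add_nonneg_eq_0_iff field_simps)
  qed auto
  also have "(\<lambda>x::real. x ^ k * indicator {0..1} x)
      = (\<lambda>x. indicator {0..} x *\<^sub>R (\<bar>x\<bar> ^ k * indicator {-1..1} x))"
    by (auto simp: fun_eq_iff indicator_def)
  finally have "has_bochner_integral lborel
      (\<lambda>x::real. indicator {0..} x *\<^sub>R (\<bar>x\<bar> ^ k * indicator {-1..1} x)) (1 / (real k + 1))"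
    by simp
  moreover have "\<bar>- x\<bar> ^ k * indicator {-1..1} (- x) = (\<bar>x\<bar> ^ k * indicator {-1..1} x :: real)" for x :: real
    by (auto simp: indicator_def)
  ultimately have "has_bochner_integral lborel (\<lambda>x::real. \<bar>x\<bar> ^ k * indicator {-1..1} x) (2 *\<^sub>R (1 / (real k + 1)))"
    by (rule has_bochner_integral_even_function)
  then show ?thesis
    by simp
qed

lemma integral_abs_power:
  "(\<integral>x. \<bar>x\<bar> ^ k * indicator {-1..1} x \<partial>lborel) = 2 / (real k + 1)"
  using has_bochner_integral_abs_power by (rule has_bochner_integral_integral_eq)

lemma integral_abs_power_mult_bump:
  "(\<integral>x. \<bar>x\<bar> ^ k * ((1 - \<bar>x\<bar> ^ n)\<^sup>2 * indicator {-1..1} x) \<partial>lborel)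
    = 2 * (1 / (real k + 1) - 2 / (real k + real n + 1) + 1 / (real k + 2 * real n + 1))"
proof -
  have "has_bochner_integral lborel (\<lambda>x::real. \<bar>x\<bar> ^ k * indicator {-1..1} x
      - 2 * (\<bar>x\<bar> ^ (k + n) * indicator {-1..1} x) + \<bar>x\<bar> ^ (k + 2 * n) * indicator {-1..1} x)
      (2 / (real k + 1) - 2 * (2 / (real (k + n) + 1)) + 2 / (real (k + 2 * n) + 1))"
    by (intro has_bochner_integral_add has_bochner_integral_diff has_bochner_integral_mult_right
        has_bochner_integral_abs_power)
  also have "(\<lambda>x::real. \<bar>x\<bar> ^ k * indicator {-1..1} x
      - 2 * (\<bar>x\<bar> ^ (k + n) * indicator {-1..1} x) + \<bar>x\<bar> ^ (k + 2 * n) * indicator {-1..1} x)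
      = (\<lambda>x. \<bar>x\<bar> ^ k * ((1 - \<bar>x\<bar> ^ n)\<^sup>2 * indicator {-1..1} x))"
    by (auto simp: fun_eq_iff indicator_def power_add power_mult power2_eq_square algebra_simps
        simp flip: power_mult_distrib)
  finally show ?thesis
    by (simp add: has_bochner_integral_integral_eq algebra_simps)
qed

text \<open>The normalising factor of \<open>fam t n\<close>; it makes the squared norm equal to \<open>1 / t\<close>.\<close>

definition fam_scale :: "real \<Rightarrow> nat \<Rightarrow> real" where
  "fam_scale t n = sqrt ((2 * real n + 1) * (real n + 1) / (4 * (real n)\<^sup>2 * t))"

text \<open>The piecewise derivative of \<open>fam t n\<close>.  Its value at the corner \<open>0\<close> is immaterial; using a case
  distinction instead of \<open>sgn\<close> keeps its modulus equal to a multiple of \<open>\<bar>x\<bar> ^ (n - 1)\<close> at \<open>0\<close> also for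
  \<open>n = 1\<close>.\<close>

definition fam_deriv :: "real \<Rightarrow> nat \<Rightarrow> real \<Rightarrow> complex" where
  "fam_deriv t n x = complex_of_real
     (fam_scale t n * ((if x < 0 then real n else - real n) * \<bar>x\<bar> ^ (n - 1)) * indicator {-1..1} x)"

lemma fam_eq: "fam t n x = complex_of_real (fam_scale t n * (1 - \<bar>x\<bar> ^ n) * indicator {-1..1} x)"
  by (simp add: fam_def fam_scale_def)

lemma fam_scale_power2:
  assumes "t > 0"
  shows "(fam_scale t n)\<^sup>2 = (2 * real n + 1) * (real n + 1) / (4 * (real n)\<^sup>2 * t)"
  using assms by (simp add: fam_scale_def)

lemma norm_fam_power2: "(cmod (fam t n x))\<^sup>2 = (fam_scale t n)\<^sup>2 * ((1 - \<bar>x\<bar> ^ n)\<^sup>2 * indicator {-1..1} x)"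
  by (simp add: fam_eq norm_mult power_mult_distrib indicator_def del: of_real_mult of_real_diff of_real_power)

lemma norm_fam_deriv_power2:
  "(cmod (fam_deriv t n x))\<^sup>2
    = (fam_scale t n)\<^sup>2 * (real n)\<^sup>2 * (\<bar>x\<bar> ^ (2 * (n - 1)) * indicator {-1..1} x)"
  by (simp add: fam_deriv_def norm_mult power_mult_distrib indicator_def power_mult[symmetric] mult.commute
      del: of_real_mult of_real_diff of_real_power)

lemma l2norm_fam:
  assumes "t > 0" "n \<ge> 1"
  shows "(l2norm (fam t n))\<^sup>2 = 1 / t"
proof -
  have "(l2norm (fam t n))\<^sup>2 = (fam_scale t n)\<^sup>2 * (2 * (1 - 2 / (real n + 1) + 1 / (2 * real n + 1)))"
    using integral_abs_power_mult_bump[of 0 n] by (simp add: l2norm_power2 norm_fam_power2)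
  also have "1 - 2 / (real n + 1) + 1 / (2 * real n + 1) = 2 * (real n)\<^sup>2 / ((2 * real n + 1) * (real n + 1))"
    by (simp add: divide_simps power2_eq_square) (simp add: algebra_simps)
  finally show ?thesis
    using assms by (simp add: fam_scale_power2)
qed

lemma time_variance_fam:
  assumes "t > 0" "n \<ge> 1"
  shows "time_variance (fam t n)
    = (real n + 1) * (2 * real n + 1) / (3 * (real n + 3) * (2 * real n + 3))"
proof -
  have mean: "time_mean (fam t n) = 0"
    by (rule time_mean_even) (auto simp: fam_eq indicator_def)
  have "time_variance (fam t n)
      = t * (\<integral>x. (fam_scale t n)\<^sup>2 * (\<bar>x\<bar> ^ 2 * ((1 - \<bar>x\<bar> ^ n)\<^sup>2 * indicator {-1..1} x)) \<partial>lborel)"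
    using assms by (simp add: time_variance_def mean l2norm_fam norm_fam_power2 mult_ac)
  also have "\<dots> = t * ((fam_scale t n)\<^sup>2 * (2 * (1 / 3 - 2 / (real n + 3) + 1 / (2 * real n + 3))))"
    by (simp only: integral_mult_right_zero integral_abs_power_mult_bump) (simp add: add_ac)
  also have "1 / 3 - 2 / (real n + 3) + 1 / (2 * real n + 3)
      = 2 * (real n)\<^sup>2 / (3 * (real n + 3) * (2 * real n + 3))"
    by (simp add: divide_simps power2_eq_square) (simp add: algebra_simps)
  finally show ?thesis
    using assms by (simp add: fam_scale_power2 mult_ac)
qed

lemma has_real_derivative_abs:
  fixes x :: real
  assumes "x \<noteq> 0"
  shows "(abs has_real_derivative sgn x) (at x)"
proof (cases "x > 0")
  case True
  have "((\<lambda>x. x) has_real_derivative sgn x) (at x)"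
    using True by simp
  then show ?thesis
    by (rule has_field_derivative_transform_within_open[where S = "{0<..}"]) (use True in auto)
next
  case False
  have "((\<lambda>x. - x) has_real_derivative sgn x) (at x)"
    using False assms by (auto intro!: derivative_eq_intros)
  then show ?thesis
    by (rule has_field_derivative_transform_within_open[where S = "{..<0}"]) (use False assms in auto)
qed

lemma fam_has_vector_derivative:
  assumes "x \<in> {-1<..<1} - {0}" "n \<ge> 1"
  shows "(fam t n has_vector_derivative fam_deriv t n x) (at x)"
proof -
  have "((\<lambda>x. fam_scale t n * (1 - \<bar>x\<bar> ^ n)) has_real_derivative
      fam_scale t n * ((if x < 0 then real n else - real n) * \<bar>x\<bar> ^ (n - 1))) (at x)"
    using DERIV_cmult[OF DERIV_diff[OF DERIV_const DERIV_power[OF has_real_derivative_abs, of x n]],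
        of "fam_scale t n" 1] assms
    by (auto simp: sgn_if split: if_splits)
  then have "((\<lambda>x. complex_of_real (fam_scale t n * (1 - \<bar>x\<bar> ^ n))) has_vector_derivative
      complex_of_real (fam_scale t n * ((if x < 0 then real n else - real n) * \<bar>x\<bar> ^ (n - 1)))) (at x)"
    by (intro has_vector_derivative_of_real) (simp add: has_real_derivative_iff_has_vector_derivative)
  also have "complex_of_real (fam_scale t n * ((if x < 0 then real n else - real n) * \<bar>x\<bar> ^ (n - 1)))
      = fam_deriv t n x"
    using assms by (simp add: fam_deriv_def)
  finally show ?thesis
    by (rule has_vector_derivative_transform_within_open[of _ _ _ "{-1<..<1}"])
       (use assms in \<open>auto simp: fam_eq\<close>)
qed

lemma isCont_fam_deriv:
  assumes "x \<notin> {-1, 0, 1}"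
  shows "isCont (fam_deriv t n) x"
proof -
  \<comment> \<open>Near \<open>x\<close> the function is a fixed multiple of a power of \<open>\<bar>y\<bar>\<close>, with factor \<open>0\<close> outside
    \<open>[-1, 1]\<close>.\<close>
  have "\<exists>U. open U \<and> x \<in> U \<and> (\<exists>c. \<forall>y\<in>U. fam_deriv t n y = of_real (c * \<bar>y\<bar> ^ (n - 1)))"
  proof -
    consider "x < -1" | "x \<in> {-1<..<0}" | "x \<in> {0<..<1}" | "x > 1"
      using assms by fastforce
    then show ?thesis
    proof cases
      case 1 then show ?thesis
        by (intro exI[of _ "{..< -1}"] exI[of _ 0] conjI) (auto simp: fam_deriv_def)
    next
      case 2 then show ?thesis
        by (intro exI[of _ "{-1<..<0}"] conjI exI[of _ "fam_scale t n * real n"])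
           (auto simp: fam_deriv_def)
    next
      case 3 then show ?thesis
        by (intro exI[of _ "{0<..<1}"] conjI exI[of _ "fam_scale t n * - real n"])
           (auto simp: fam_deriv_def)
    next
      case 4 then show ?thesis
        by (intro exI[of _ "{1<..}"] exI[of _ 0] conjI) (auto simp: fam_deriv_def)
    qed
  qed
  then obtain U c where U: "open U" "x \<in> U" "\<And>y. y \<in> U \<Longrightarrow> fam_deriv t n y = of_real (c * \<bar>y\<bar> ^ (n - 1))"
    by blast
  have "eventually (\<lambda>y. fam_deriv t n y = of_real (c * \<bar>y\<bar> ^ (n - 1))) (nhds x)"
    using U by (auto simp: eventually_nhds)
  then have "isCont (fam_deriv t n) x \<longleftrightarrow> isCont (\<lambda>y. complex_of_real (c * \<bar>y\<bar> ^ (n - 1))) x"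
    by (rule isCont_cong)
  then show ?thesis
    by (simp add: continuous_intros)
qed

lemma norm_fam_deriv_le: "cmod (fam_deriv t n x) \<le> \<bar>fam_scale t n\<bar> * real n"
proof (cases "x \<in> {-1..1}")
  case True
  then have "\<bar>x\<bar> ^ (n - 1) \<le> 1"
    by (intro power_le_one) auto
  then show ?thesis
    using True by (auto simp: fam_deriv_def norm_mult abs_mult mult_left_le intro!: mult_left_mono
        simp del: of_real_mult)
qed (auto simp: fam_deriv_def)

lemma freq_variance_fam:
  assumes "t > 0" "n \<ge> 1"
  shows "freq_variance (fam t n)
    = ennreal ((real n + 1) * (2 * real n + 1) / (2 * (2 * real n - 1)))"
proof -
  have [measurable]: "fam_deriv t n \<in> borel_measurable borel"
    unfolding fam_deriv_def[abs_def] by measurable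
  have "freq_variance (fam t n)
      = ennreal ((\<integral>x. (cmod (fam_deriv t n x))\<^sup>2 \<partial>lborel) / (l2norm (fam t n))\<^sup>2)"
  proof (rule freq_variance_eq_derivative_energy)
    show "continuous_on {-1..1} (fam t n)"
    proof (rule continuous_on_eq)
      show "continuous_on {-1..1} (\<lambda>x. complex_of_real (fam_scale t n * (1 - \<bar>x\<bar> ^ n)))"
        by (intro continuous_intros)
    qed (simp add: fam_eq)
    show "(fam t n has_vector_derivative fam_deriv t n x) (at x)" if "x \<in> {-1<..<1} - {0}" for x
      using that assms(2) by (rule fam_has_vector_derivative)
    show "integrable lborel (fam_deriv t n)"
    proof (rule Bochner_Integration.integrable_bound)
      show "integrable lborel (\<lambda>x::real. (\<bar>fam_scale t n\<bar> * real n) * indicator {-1..1} x)"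
        by simp
      show "AE x in lborel. cmod (fam_deriv t n x)
          \<le> norm ((\<bar>fam_scale t n\<bar> * real n) * indicator {-1..1} x)"
      proof (rule AE_I2)
        fix x
        show "cmod (fam_deriv t n x) \<le> norm ((\<bar>fam_scale t n\<bar> * real n) * indicator {-1..1} x)"
          using norm_fam_deriv_le[of t n x] by (cases "x \<in> {-1..1}") (auto simp: fam_deriv_def)
      qed
    qed measurable
    show "cmod (fam_deriv t n x) \<le> \<bar>fam_scale t n\<bar> * real n" for x
      by (rule norm_fam_deriv_le)
    show "AE x in lborel. isCont (fam_deriv t n) x"
    proof (rule AE_I')
      show "{-1, 0, 1::real} \<in> null_sets lborel"
        by (intro finite_imp_null_set_lborel) auto
      show "{x \<in> space lborel. \<not> isCont (fam_deriv t n) x} \<subseteq> {-1, 0, 1}"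
        using isCont_fam_deriv by blast
    qed
  qed (use assms in \<open>auto simp: fam_eq fam_deriv_def\<close>)
  also have "(\<integral>x. (cmod (fam_deriv t n x))\<^sup>2 \<partial>lborel)
      = (fam_scale t n)\<^sup>2 * (real n)\<^sup>2 * (2 / (2 * real n - 1))"
    using assms(2) by (simp only: norm_fam_deriv_power2 integral_mult_right_zero integral_abs_power)
       (simp add: of_nat_diff)
  also have "\<dots> / (l2norm (fam t n))\<^sup>2 = (real n + 1) * (2 * real n + 1) / (2 * (2 * real n - 1))"
    unfolding l2norm_fam[OF assms] fam_scale_power2[OF assms(1)] using assms
    by (simp add: divide_simps power2_eq_square)
  finally show ?thesis .
qed

text \<open>The uncertainty product of \<open>fam t n\<close> in closed form, for \<open>n \<ge> 1\<close>; it does not depend on \<open>t\<close>.\<close>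

definition fam_uncertainty :: "nat \<Rightarrow> real" where
  "fam_uncertainty n = ((real n + 1) * (2 * real n + 1))\<^sup>2
     / (6 * (real n + 3) * (2 * real n + 3) * (2 * real n - 1))"

lemma uncertainty_fam:
  assumes "t > 0" "n \<ge> 1"
  shows "uncertainty (fam t n) = ennreal (fam_uncertainty n)"
proof -
  have "uncertainty (fam t n) = ennreal ((real n + 1) * (2 * real n + 1) / (3 * (real n + 3) * (2 * real n + 3))
      * ((real n + 1) * (2 * real n + 1) / (2 * (2 * real n - 1))))"
    unfolding uncertainty_def time_variance_fam[OF assms] freq_variance_fam[OF assms]
    by (subst ennreal_mult') auto
  also have "(real n + 1) * (2 * real n + 1) / (3 * (real n + 3) * (2 * real n + 3))
      * ((real n + 1) * (2 * real n + 1) / (2 * (2 * real n - 1))) = fam_uncertainty n"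
    unfolding fam_uncertainty_def times_divide_times_eq power2_eq_square
    by (rule arg_cong2[where f = "(/)"]) (auto simp: algebra_simps)
  finally show ?thesis .
qed

lemma fam_uncertainty_1: "fam_uncertainty 1 = 3 / 10"
  by (simp add: fam_uncertainty_def)

lemma fam_uncertainty_gt:
  assumes "n \<ge> 2"
  shows "3 / 10 < fam_uncertainty n"
proof -
  \<comment> \<open>In terms of \<open>m = n - 2\<close> the difference of the cleared fractions has positive coefficients.\<close>
  define m where "m = real n - 2"
  have m: "m \<ge> 0" "real n = m + 2"
    using assms by (auto simp: m_def)
  have "0 < 6 * (real n + 3) * (2 * real n + 3) * (2 * real n - 1)"
    using m by simp
  moreover have "10 * ((real n + 1) * (2 * real n + 1))\<^sup>2
      - 3 * (6 * (real n + 3) * (2 * real n + 3) * (2 * real n - 1))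
      = 40 * m ^ 4 + 368 * m ^ 3 + 1090 * m\<^sup>2 + 1122 * m + 360"
    unfolding m by algebra
  moreover have "0 < 40 * m ^ 4 + 368 * m ^ 3 + 1090 * m\<^sup>2 + 1122 * m + 360"
    using m(1) by (intro add_nonneg_pos add_nonneg_nonneg mult_nonneg_nonneg zero_le_power) auto
  ultimately show ?thesis
    unfolding fam_uncertainty_def by (subst less_divide_eq) simp
qed

text \<open>The bound with the true rate \<open>n / 6\<close> fails for \<open>n \<ge> 3\<close>; half of it is enough for unboundedness.\<close>

lemma fam_uncertainty_ge_linear:
  assumes "n \<ge> 1"
  shows "real n / 12 \<le> fam_uncertainty n"
proof -
  define m where "m = real n - 1"
  have m: "m \<ge> 0" "real n = m + 1"
    using assms by (auto simp: m_def)
  have "0 < 6 * (real n + 3) * (2 * real n + 3) * (2 * real n - 1)"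
    using m by simp
  moreover have "12 * ((real n + 1) * (2 * real n + 1))\<^sup>2
      - real n * (6 * (real n + 3) * (2 * real n + 3) * (2 * real n - 1)) \<ge> 0"
    unfolding m using m(1) by (simp add: algebra_simps power2_eq_square)
  ultimately show ?thesis
    unfolding fam_uncertainty_def by (subst le_divide_eq) simp
qed

lemma fam_uncertainty_asymp: "(\<lambda>n. fam_uncertainty n / (real n / 6)) \<longlonglongrightarrow> 1"
  unfolding fam_uncertainty_def by real_asymp

section \<open>The rectangular function\<close>

lemma fourier_rect: "\<i> * complex_of_real \<omega> * fourier rect \<omega> = 2 * \<i> * complex_of_real (sin (\<omega> / 2))"
proof -
  define E where "E x = exp (- \<i> * complex_of_real (\<omega> * x))" for x
  have "(\<integral>x. indicator {-1/2..1/2} x *\<^sub>R ((\<i> * complex_of_real \<omega>) * E x) \<partial>lborel) = - E (1/2) - - E (-1/2)"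
  proof (rule integral_FTC_Icc)
    show "((\<lambda>x. - E x) has_vector_derivative (\<i> * complex_of_real \<omega>) * E x) (at x within {-1/2..1/2})" for x
      using has_vector_derivative_minus[OF has_vector_derivative_fourier_kernel[of \<omega> x]]
      unfolding E_def by simp
    show "continuous_on {-1/2..1/2} (\<lambda>x. \<i> * complex_of_real \<omega> * E x)"
      unfolding E_def by (intro continuous_intros)
  qed simp
  also have "(\<integral>x. indicator {-1/2..1/2} x *\<^sub>R ((\<i> * complex_of_real \<omega>) * E x) \<partial>lborel)
      = (\<integral>x. (\<i> * complex_of_real \<omega>) * (E x * rect x) \<partial>lborel)"
    by (intro Bochner_Integration.integral_cong) (auto simp: rect_def indicator_def)
  also have "\<dots> = \<i> * complex_of_real \<omega> * fourier rect \<omega>"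
    by (simp only: integral_mult_right_zero fourier_def E_def)
  also have "- E (1/2) - - E (-1/2) = cis (\<omega> / 2) - cis (- \<omega> / 2)"
    by (simp add: E_def cis_conv_exp)
  also have "\<dots> = 2 * \<i> * complex_of_real (sin (\<omega> / 2))"
    by (simp add: complex_eq_iff)
  finally show ?thesis .
qed

lemma freq_variance_rect: "freq_variance rect = \<infinity>"
proof -
  define I where "I = (\<integral>\<^sup>+\<omega>. ennreal (4 * (sin (\<omega> / 2))\<^sup>2) \<partial>lborel)"
  have "\<omega>\<^sup>2 * (cmod (fourier rect \<omega>))\<^sup>2 = 4 * (sin (\<omega> / 2))\<^sup>2" for \<omega>
  proof -
    have "(cmod (\<i> * complex_of_real \<omega> * fourier rect \<omega>))\<^sup>2 = 4 * (sin (\<omega> / 2))\<^sup>2"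
      unfolding fourier_rect by (simp add: norm_mult power_mult_distrib)
    then show ?thesis
      by (simp add: norm_mult power_mult_distrib)
  qed
  then have "(\<integral>\<^sup>+\<omega>. ennreal (\<omega>\<^sup>2 * (cmod (fourier rect \<omega>))\<^sup>2) \<partial>lborel) = I"
    by (simp add: I_def)
  moreover have "I = \<infinity>"
  proof -
    \<comment> \<open>Translation by \<open>\<pi>\<close> turns the sine into a cosine, so \<open>2 I\<close> is the integral of the constant \<open>4\<close>.\<close>
    have "I = (\<integral>\<^sup>+\<omega>. ennreal (4 * (cos (\<omega> / 2))\<^sup>2) \<partial>lborel)"
      unfolding I_def
      by (subst nn_integral_real_affine[where c = 1 and t = pi]) (auto simp: add_divide_distrib sin_add)
    then have "I + I = (\<integral>\<^sup>+\<omega>. ennreal (4 * (sin (\<omega> / 2))\<^sup>2) + ennreal (4 * (cos (\<omega> / 2))\<^sup>2) \<partial>lborel)"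
      by (subst nn_integral_add) (auto simp: I_def)
    also have "\<dots> = (\<integral>\<^sup>+(\<omega>::real). 4 \<partial>lborel)"
      by (intro nn_integral_cong)
         (simp add: ennreal_plus[symmetric] distrib_left[symmetric] del: ennreal_plus)
    also have "\<dots> = \<infinity>"
      by simp
    finally show ?thesis
      by (simp add: ennreal_add_eq_top)
  qed
  ultimately show ?thesis
    by (simp add: freq_variance_def)
qed

lemma time_variance_rect_pos: "time_variance rect > 0"
proof -
  have mean: "time_mean rect = 0"
    by (rule time_mean_even) (auto simp: rect_def indicator_def)
  have sq: "(cmod (rect x))\<^sup>2 = indicator {-1/2..1/2} x" for x
    by (simp add: rect_def indicator_def)
  have "(l2norm rect)\<^sup>2 = 1"
    by (simp add: l2norm_power2 sq)
  moreover have "(\<integral>x. x\<^sup>2 * indicator {-1/2..1/2::real} x \<partial>lborel) = ((1/2) ^ 3 / 3 :: real) - (-1/2) ^ 3 / 3"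
  proof (rule integral_FTC_Icc_real)
    show "((\<lambda>x. x ^ 3 / 3) has_real_derivative x\<^sup>2) (at x)" for x
      by (rule derivative_eq_intros refl | simp)+
  qed auto
  ultimately show ?thesis
    by (simp add: time_variance_def mean sq power3_eq_cube)
qed

lemma uncertainty_rect: "uncertainty rect = \<infinity>"
  using time_variance_rect_pos by (simp add: uncertainty_def freq_variance_rect ennreal_mult_top)

section \<open>Extremal members and growth\<close>

theorem theorem2p3:
  fixes t :: real
  assumes "t > 0"
  shows "(INF n\<in>{1..}. uncertainty (fam t n)) = uncertainty (fam t 1)
    \<and> uncertainty (fam t 1) = ennreal (3 / 10)
    \<and> (\<forall>n. is_arg_min (\<lambda>n. uncertainty (fam t n)) (\<lambda>n. n \<ge> 1) n \<longleftrightarrow> n = 1)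
    \<and> fam t 1 = (\<lambda>x. complex_of_real (sqrt (3 / (2 * t)) * (1 - \<bar>x\<bar>) * indicator {-1..1} x))
    \<and> (\<lambda>n. uncertainty (fam t n) / ennreal (real n / 6)) \<longlonglongrightarrow> 1
    \<and> (SUP n\<in>{1..}. uncertainty (fam t n)) = \<infinity>
    \<and> uncertainty rect = \<infinity>
    \<and> (SUP n. uncertainty (ext_fam t n)) = uncertainty (ext_fam t 0)"
proof (intro conjI)
  note U = uncertainty_fam[OF assms]
  show U1: "uncertainty (fam t 1) = ennreal (3 / 10)"
    by (simp only: U[OF order_refl] fam_uncertainty_1)
  have U2: "uncertainty (fam t 1) < uncertainty (fam t n)" if "n \<ge> 2" for n
    using fam_uncertainty_gt[OF that] that unfolding U1 by (simp add: U ennreal_lessI)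
  have U_min: "uncertainty (fam t 1) \<le> uncertainty (fam t n)" if "n \<ge> 1" for n
    using U2[of n] that by (cases "n = 1") (auto simp: less_imp_le)
  show "(INF n\<in>{1..}. uncertainty (fam t n)) = uncertainty (fam t 1)"
    using U_min by (intro antisym INF_lower INF_greatest) auto
  show "\<forall>n. is_arg_min (\<lambda>n. uncertainty (fam t n)) (\<lambda>n. n \<ge> 1) n \<longleftrightarrow> n = 1"
  proof
    fix n
    show "is_arg_min (\<lambda>n. uncertainty (fam t n)) (\<lambda>n. n \<ge> 1) n \<longleftrightarrow> n = 1"
    proof
      assume *: "is_arg_min (\<lambda>n. uncertainty (fam t n)) (\<lambda>n. n \<ge> 1) n"
      show "n = 1"
      proof (rule ccontr)
        assume "n \<noteq> 1"
        with * have "n \<ge> 2"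
          by (auto simp: is_arg_min_def)
        with U2 * show False
          by (auto simp: is_arg_min_def)
      qed
    next
      assume "n = 1"
      then show "is_arg_min (\<lambda>n. uncertainty (fam t n)) (\<lambda>n. n \<ge> 1) n"
        using U_min by (auto simp: is_arg_min_def not_less)
    qed
  qed
  show "fam t 1 = (\<lambda>x. complex_of_real (sqrt (3 / (2 * t)) * (1 - \<bar>x\<bar>) * indicator {-1..1} x))"
    by (simp add: fam_def fun_eq_iff)
  show "(\<lambda>n. uncertainty (fam t n) / ennreal (real n / 6)) \<longlonglongrightarrow> 1"
  proof (rule Lim_transform_eventually)
    show "(\<lambda>n. ennreal (fam_uncertainty n / (real n / 6))) \<longlonglongrightarrow> 1"
      using tendsto_ennrealI[OF fam_uncertainty_asymp] by simp
    show "\<forall>\<^sub>F n in sequentially. ennreal (fam_uncertainty n / (real n / 6))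
        = uncertainty (fam t n) / ennreal (real n / 6)"
      using eventually_ge_at_top[of 1]
    proof eventually_elim
      case (elim n)
      then have "0 \<le> fam_uncertainty n" "0 < real n / 6"
        using fam_uncertainty_ge_linear[of n] by (auto intro: order_trans[rotated])
      then show ?case
        using elim by (simp only: U divide_ennreal)
    qed
  qed
  show "(SUP n\<in>{1..}. uncertainty (fam t n)) = \<infinity>"
  proof -
    have "of_nat m \<le> (SUP n\<in>{1..}. uncertainty (fam t n))" for m
    proof -
      have "ennreal (real m) \<le> ennreal (fam_uncertainty (12 * (m + 1)))"
        using fam_uncertainty_ge_linear[of "12 * (m + 1)"] by (intro ennreal_leI) simp
      also have "\<dots> = uncertainty (fam t (12 * (m + 1)))"
        by (subst U) auto
      also have "\<dots> \<le> (SUP n\<in>{1..}. uncertainty (fam t n))"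
        by (rule SUP_upper) auto
      finally show ?thesis
        by (simp add: ennreal_of_nat_eq_real_of_nat)
    qed
    then have "(SUP m. of_nat m :: ennreal) \<le> (SUP n\<in>{1..}. uncertainty (fam t n))"
      by (intro SUP_least) auto
    then show ?thesis
      by (simp add: ennreal_SUP_of_nat_eq_top top.extremum_unique)
  qed
  show "uncertainty rect = \<infinity>"
    by (rule uncertainty_rect)
  have "uncertainty (ext_fam t 0) = top"
    by (simp add: ext_fam_def uncertainty_rect)
  then show "(SUP n. uncertainty (ext_fam t n)) = uncertainty (ext_fam t 0)"
    by (intro antisym SUP_upper) auto
qed

end
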